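(* Let $n\ge 2$ and let $X\subset\mathbb{R}^n$ be a non-empty bounded convex domain, equipped with its Hilbert metric $d$. Then the boundary $\partial X=\overline{X}\setminus X$ (where $\overline X$ is the closure of $X$ in $\mathbb{R}^n$) is a corona of the Hilbert geometry $(X,d)$ (with respect to the compactification $\overline X$) if and only if the closure $\overline{X}$ is properly convex in $\mathbb{R}^n$.
   Context: Hilbert geometry: for a non-empty bounded convex domain (open set) $X\subset\mathbb{R}^n$, $n\ge 2$, and distinct $x,y\in X$, the line through $x$ and $y$ meets $\partial X$ in exactly two points $x',y'$, labelled so that $x',x,y,y'$ are in this order; set $d(x,y)=\log\frac{|xy'||yx'|}{|xx'||yy'|}$ ($|\cdot\,\cdot|$ is Euclidean distance) and $d(x,x)=0$. This is the Hilbert metric and $(X,d)$ is the Hilbert geometry. It is a proper metric space (closed bounded sets are compact) whose topology is the Euclidean one, so $\overline X$ is a compactification of $(X,d)$. Properly convex: a subset $A\subset\mathbb{R}^n$ is properly convex if for all $x,y\in A$, every point $z$ of the segment $[x,y]$ distinct from $x$ and $y$ lies in the interior of $A$. Higson function: for a proper metric space $(Y,d_Y)$, a bounded continuous function $f:Y\to\mathbb{C}$ is a Higson function if for any $\epsilon>0$ and $C>0$ there is a bounded set $B\subset Y$ such that for all $x,y\in Y$ with $d_Y(x,y)\le C$ and $x\notin B$ one has $|f(x)-f(y)|<\epsilon$. Corona: a metrizable compactification $\overline Y$ of a proper metric space $Y$ is a coarse compactification if the restriction to $Y$ of every continuous ($\mathbb{C}$-valued) function on $\overline Y$ is a Higson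 function on $Y$. In this case the boundary $\overline Y\setminus Y$ is called a corona of $Y$. *)

theory Defs
  imports "HOL-Analysis.Analysis"
begin

context Metric_space
begin

definition proper_space :: bool where
  "proper_space \<longleftrightarrow>
     (\<forall>S. closedin mtopology S \<and> mbounded S \<longrightarrow> compactin mtopology S)"

text \<open>Only the values of \<open>f\<close> on the carrier \<open>M\<close> matter, so that the predicate applied to a function
  given on a larger set speaks about its restriction to \<open>M\<close>.\<close>

definition Higson_function :: "('a \<Rightarrow> complex) \<Rightarrow> bool" where
  "Higson_function f \<longleftrightarrow>
     continuous_map mtopology euclidean f \<and> bounded (f ` M) \<and>
     (\<forall>\<epsilon>>0. \<forall>C>0. \<exists>B\<subseteq>M. mbounded B \<and>
        (\<forall>x\<in>M. \<forall>y\<in>M. d x y \<le> C \<and> x \<notin> B \<longrightarrow> cmod (f x - f y) < \<epsilon>))"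

text \<open>The compactification contains the metric space as a subset, with the subspace topology.
  When the space is proper, \<open>M\<close> is automatically open in \<open>T\<close>.\<close>

definition metrizable_compactification :: "'a topology \<Rightarrow> bool" where
  "metrizable_compactification T \<longleftrightarrow>
     compact_space T \<and> metrizable_space T \<and>
     M \<subseteq> topspace T \<and> subtopology T M = mtopology \<and> T closure_of M = topspace T"

definition coarse_compactification :: "'a topology \<Rightarrow> bool" where
  "coarse_compactification T \<longleftrightarrow>
     metrizable_compactification T \<and>
     (\<forall>f. continuous_map T euclidean f \<longrightarrow> Higson_function f)"

end

text \<open>\<open>corona Y d T B\<close>: the set \<open>B\<close> is the corona of the proper metric space \<open>(Y, d)\<close> with respect to
  its compactification \<open>T\<close>. That \<open>(Y, d)\<close> is a proper metric space is part of the predicate, since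
  the constants of the locale \<open>Metric_space\<close> are meaningless for an arbitrary function \<open>d\<close>.\<close>

definition corona :: "'a set \<Rightarrow> ('a \<Rightarrow> 'a \<Rightarrow> real) \<Rightarrow> 'a topology \<Rightarrow> 'a set \<Rightarrow> bool" where
  "corona Y d T B \<longleftrightarrow>
     Metric_space Y d \<and> Metric_space.proper_space Y d \<and>
     Metric_space.coarse_compactification Y d T \<and> B = topspace T - Y"

definition properly_convex :: "'a::euclidean_space set \<Rightarrow> bool" where
  "properly_convex A \<longleftrightarrow> (\<forall>x\<in>A. \<forall>y\<in>A. open_segment x y \<subseteq> interior A)"

text \<open>The line through \<open>x\<close> and \<open>y\<close> meets the boundary exactly in \<open>x'\<close> and \<open>y'\<close>, and \<open>x', x, y, y'\<close>
  lie on it in this order.\<close>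

definition chord_ends ::
  "'a::euclidean_space set \<Rightarrow> 'a \<Rightarrow> 'a \<Rightarrow> 'a \<Rightarrow> 'a \<Rightarrow> bool" where
  "chord_ends X x y x' y' \<longleftrightarrow>
     frontier X \<inter> affine hull {x, y} = {x', y'} \<and>
     x \<in> open_segment x' y \<and> y \<in> open_segment x y'"

text \<open>The value outside \<open>X\<close> is irrelevant; it is \<open>0\<close> because the locale \<open>Metric_space\<close> demands
  symmetry and nonnegativity on the whole type.\<close>

definition hilbert_dist :: "'a::euclidean_space set \<Rightarrow> 'a \<Rightarrow> 'a \<Rightarrow> real" where
  "hilbert_dist X x y =
     (if x \<in> X \<and> y \<in> X \<and> x \<noteq> y
      then THE r. \<exists>x' y'. chord_ends X x y x' y' \<and>
             r = ln ((dist x y' * dist y x') / (dist x x' * dist y y'))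
      else 0)"

lemma chord_ends_exist:
  fixes X :: "'a::euclidean_space set"
  assumes "open X" "convex X" "bounded X" "x \<in> X" "y \<in> X" "x \<noteq> y"
  shows "\<exists>x' y'. chord_ends X x y x' y'"
proof -
  have int: "interior X = X" using assms(1) by (rule interior_open)
  define P where "P t = x + t *\<^sub>R (y - x)" for t :: real
  have P01: "P 0 = x" "P 1 = y" by (auto simp: P_def)
  have seg: "P b \<in> open_segment (P a) (P c)" if "a < b" "b < c" for a b c
  proof -
    define u where "u = (b - a) / (c - a)"
    have u: "0 < u" "u < 1" using that by (auto simp: u_def field_simps)
    have ub: "b = a + u * (c - a)" using that by (simp add: u_def)
    have "P b = (1 - u) *\<^sub>R P a + u *\<^sub>R P c"
      unfolding P_def ub by (simp add: algebra_simps)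
    moreover have "P a \<noteq> P c" using that assms(6) by (auto simp: P_def)
    ultimately show ?thesis using u by (auto simp: in_segment)
  qed
  have fr: "z \<in> closure X" "z \<notin> X" if "z \<in> frontier X" for z
    using that int by (auto simp: frontier_def)
  have hit: False if "P s \<in> X" "P b \<in> frontier X" "P c \<in> frontier X"
      "s < b \<and> b < c \<or> c < b \<and> b < s" for s b c
  proof -
    have "P b \<in> open_segment (P s) (P c)"
      using that(4) seg[of s b c] seg[of c b s] by (auto simp: open_segment_commute)
    then have "P b \<in> interior X"
      using in_interior_closure_convex_segment[OF assms(2), of "P s" "P c"] that fr int by blast
    then show False using fr that int by auto
  qed
  have "y - x \<noteq> 0" "x - y \<noteq> 0" using assms by auto
  obtain e where e: "0 < e" "y + e *\<^sub>R (y - x) \<in> frontier X"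
    using ray_to_frontier[OF assms(3), of y "y - x"] assms(4,5) int \<open>y - x \<noteq> 0\<close> by metis
  obtain f where f: "0 < f" "x + f *\<^sub>R (x - y) \<in> frontier X"
    using ray_to_frontier[OF assms(3), of x "x - y"] assms(4,5) int \<open>x - y \<noteq> 0\<close> by metis
  have q: "P (1 + e) \<in> frontier X" using e by (simp add: P_def algebra_simps)
  have p: "P (- f) \<in> frontier X" using f by (simp add: P_def algebra_simps)
  have line: "z \<in> affine hull {x, y} \<longleftrightarrow> (\<exists>t. z = P t)" for z
  proof -
    have "\<exists>t. z = P t" if "z = u *\<^sub>R x + v *\<^sub>R y" "u + v = 1" for u v
    proof
      have "u = 1 - v" using that(2) by simp
      show "z = P v" unfolding that(1) P_def \<open>u = 1 - v\<close> by (simp add: algebra_simps)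
    qed
    moreover have "P t = (1 - t) *\<^sub>R x + t *\<^sub>R y" for t by (simp add: P_def algebra_simps)
    moreover have "(1 - t) + t = 1" for t :: real by simp
    ultimately show ?thesis unfolding affine_hull_2 by blast
  qed
  have two: "t = - f \<or> t = 1 + e" if "P t \<in> frontier X" for t
  proof (rule ccontr)
    assume neg: "\<not> ?thesis"
    have "P 0 \<in> X" "P 1 \<in> X" using assms P01 by auto
    moreover have "t \<notin> {0..1}"
    proof
      assume "t \<in> {0..1}"
      then have "(1 - t) *\<^sub>R x + t *\<^sub>R y \<in> X"
        using assms by (auto simp: convex_alt)
      moreover have "P t = (1 - t) *\<^sub>R x + t *\<^sub>R y" by (simp add: P_def algebra_simps)
      ultimately show False using fr that by auto
    qed
    then have "t < 0 \<or> t > 1" by auto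
    moreover have "t < - f \<or> - f < t \<and> t < 1 + e \<or> 1 + e < t" using neg by auto
    ultimately show False
      using hit[of 0 t "- f"] hit[of 0 "- f" t] hit[of 1 t "1 + e"] hit[of 1 "1 + e" t]
        that p q e(1) f(1) by linarith
  qed
  have "frontier X \<inter> affine hull {x, y} = {P (- f), P (1 + e)}"
  proof (intro set_eqI iffI)
    fix z assume z: "z \<in> frontier X \<inter> affine hull {x, y}"
    then obtain t where "z = P t" using line by blast
    with z two[of t] show "z \<in> {P (- f), P (1 + e)}" by auto
  next
    fix z assume "z \<in> {P (- f), P (1 + e)}"
    then obtain t where "z = P t" "P t \<in> frontier X" using p q by auto
    then show "z \<in> frontier X \<inter> affine hull {x, y}" using line[of z] by auto
  qed
  moreover have "x \<in> open_segment (P (- f)) y" "y \<in> open_segment x (P (1 + e))"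
    using seg[of "- f" 0 1] seg[of 0 1 "1 + e"] e f P01 by auto
  ultimately show ?thesis unfolding chord_ends_def by blast
qed

lemma chord_ends_unique:
  assumes "chord_ends X x y p q" "chord_ends X x y p' q'"
  shows "p = p' \<and> q = q'"
proof -
  have "{p, q} = {p', q'}" using assms by (auto simp: chord_ends_def)
  then have "(p = p' \<and> q = q') \<or> (p = q' \<and> q = p')" by (auto simp: doubleton_eq_iff)
  moreover have False if "p = q'"
  proof -
    have "x \<in> open_segment p y" "y \<in> open_segment x p"
      using assms that by (auto simp: chord_ends_def)
    then have "dist x y < dist p y" "dist y p < dist x p" "dist x p < dist p y"
      using dist_in_open_segment[of x p y] dist_in_open_segment[of y x p]
      by (auto simp: dist_commute)
    then show False by (auto simp: dist_commute)
  qed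
  ultimately show ?thesis by blast
qed

lemma hilbert_dist_eq:
  assumes "chord_ends X x y x' y'" "x \<in> X" "y \<in> X" "x \<noteq> y"
  shows "hilbert_dist X x y = ln ((dist x y' * dist y x') / (dist x x' * dist y y'))"
proof -
  have "(THE r. \<exists>x' y'. chord_ends X x y x' y' \<and>
           r = ln ((dist x y' * dist y x') / (dist x x' * dist y y')))
        = ln ((dist x y' * dist y x') / (dist x x' * dist y y'))"
    using assms(1) by (rule_tac the_equality) (blast dest: chord_ends_unique)+
  then show ?thesis using assms by (simp add: hilbert_dist_def)
qed

end

theory Submission
  imports Defs
begin

text \<open>
  Let \<open>x\<close>, \<open>y\<close> be distinct points of \<open>X\<close> whose chord ends beyond \<open>y\<close> at \<open>y'\<close>. Then \<open>y\<close> is the convex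
  combination \<open>m x + (1 - m) y'\<close> with \<open>m = |yy'| / |xy'|\<close>, and \<open>m\<close> is the largest weight for which
  \<open>y\<close> can be written as \<open>m x + (1 - m) p\<close> with \<open>p\<close> in the closure of \<open>X\<close>: a larger weight would
  push \<open>p\<close> beyond the boundary. The Hilbert distance is minus the logarithm of the product of the
  two maximal weights, for \<open>y\<close> seen from \<open>x\<close> and for \<open>x\<close> seen from \<open>y\<close>. Hence
  \<open>d x y \<le> C\<close> can be expressed by convex combinations alone, without chords
  (\<open>hilbert_dist_le_iff\<close>), and everything below rests on this reformulation.

  Composing convex combinations multiplies the weights, which is the triangle inequality. Moreover
  \<open>d x y \<le> C\<close> confines \<open>y\<close> to the image of the closure of \<open>X\<close> under a homothety centred at \<open>x\<close> of
  ratio \<open>1 - exp (- C) < 1\<close>. For fixed \<open>x\<close> this image is a compact subset of \<open>X\<close>, so bounded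
  sets are exactly those contained in compact subsets of \<open>X\<close> (\<open>mbounded_iff_in_compact\<close>) and the
  space is proper.

  Suppose the closure is properly convex and \<open>d x y \<le> C\<close>, \<open>|xy| \<ge> \<eta>\<close>. Then \<open>x = n y + (1 - n) q\<close>
  with \<open>n \<ge> exp (- C)\<close> and \<open>q\<close> in the closure. The set of all points of this form, for \<open>y\<close>, \<open>q\<close> in
  the closure, \<open>exp (- C) \<le> n \<le> 1\<close> and \<open>|xy| \<ge> \<eta>\<close>, is compact, and proper convexity places it
  inside \<open>X\<close>. So outside a bounded set, points at distance at most \<open>C\<close> are within
  Euclidean distance \<open>\<eta>\<close> (\<open>euclidean_close_outside_bounded\<close>), and uniformly continuous functions are
  Higson functions.

  Conversely, if an open segment from \<open>a\<close> to \<open>b\<close> in the closure has a point \<open>z\<close> outside \<open>X\<close>, let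
  \<open>v\<close> be the midpoint of \<open>z\<close> and \<open>b\<close>. Each of \<open>z\<close>, \<open>v\<close> is a convex combination of the other and an
  endpoint, with positive weight on the other. Moving all these points towards a point of \<open>X\<close>
  preserves the weights, so the moved copies of \<open>z\<close> and \<open>v\<close> stay at bounded Hilbert distance while
  they leave every bounded set; yet a linear functional separates them by a definite amount.
\<close>

section \<open>Hilbert distance through convex combinations\<close>

text \<open>With \<open>m = exp (- r)\<close> this is the closed ball of radius \<open>r\<close> around \<open>x\<close> for the
  asymmetric Funk metric \<open>ln (|xy'| / |yy'|)\<close>, of which the Hilbert metric is the symmetrization. The
  weight \<open>m\<close> is the parameter rather than \<open>r\<close> because weights multiply under composition.\<close>

definition funk_ball :: "'a::euclidean_space set \<Rightarrow> 'a \<Rightarrow> real \<Rightarrow> 'a set" where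
  "funk_ball X x m = (\<lambda>p. m *\<^sub>R x + (1 - m) *\<^sub>R p) ` closure X"

locale bounded_convex_domain =
  fixes X :: "'a::euclidean_space set"
  assumes open_X: "open X" and convex_X: "convex X" and bounded_X: "bounded X"
    and nonempty_X: "X \<noteq> {}"
begin

lemma interior_X: "interior X = X"
  using open_X by (rule interior_open)

lemma compact_closure_X: "compact (closure X)"
  using bounded_X by simp

lemma blend_in_closure:
  assumes "p \<in> closure X" "q \<in> closure X" "0 \<le> u" "0 \<le> v" "u + v = 1"
  shows "u *\<^sub>R p + v *\<^sub>R q \<in> closure X"
  using convex_closure[OF convex_X] assms by (rule convexD)

text \<open>An interior point drags every convex combination in which it has positive weight into the
  interior.\<close>

lemma blend_in_domain:
  assumes "x \<in> X" "p \<in> closure X" "0 < m" "m \<le> 1"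
  shows "m *\<^sub>R x + (1 - m) *\<^sub>R p \<in> X"
proof -
  have "p - m *\<^sub>R (p - x) \<in> interior X"
    using mem_interior_closure_convex_shrink[OF convex_X] assms interior_X by simp
  then show ?thesis by (simp add: interior_X algebra_simps)
qed

lemma funk_ball_one: "funk_ball X x 1 = {x}"
proof -
  have "closure X \<noteq> {}" using nonempty_X by simp
  then show ?thesis by (auto simp: funk_ball_def image_constant_conv)
qed

lemma funk_ball_antimono:
  assumes "x \<in> X" "m \<le> m'" "m' \<le> 1"
  shows "funk_ball X x m' \<subseteq> funk_ball X x m"
proof (cases "m' = 1")
  case True
  have "x = m *\<^sub>R x + (1 - m) *\<^sub>R x" by (simp add: algebra_simps)
  then have "x \<in> funk_ball X x m"
    unfolding funk_ball_def using assms(1) closure_subset by blast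
  then show ?thesis by (simp add: True funk_ball_one)
next
  case False
  with assms have m: "m < 1" "m' < 1" by auto
  show ?thesis
  proof
    fix y assume "y \<in> funk_ball X x m'"
    then obtain p where p: "p \<in> closure X" "y = m' *\<^sub>R x + (1 - m') *\<^sub>R p"
      by (auto simp: funk_ball_def)
    define c where "c = (1 - m') / (1 - m)"
    have c: "0 \<le> c" "c \<le> 1" "(1 - m) * c = 1 - m'" using m assms by (auto simp: c_def)
    have mem: "(1 - c) *\<^sub>R x + c *\<^sub>R p \<in> closure X"
      using blend_in_closure p(1) c assms(1) closure_subset[of X] by auto
    have "m + (1 - m) * (1 - c) = m'" using c(3) by (simp add: algebra_simps)
    then have "y = (m + (1 - m) * (1 - c)) *\<^sub>R x + ((1 - m) * c) *\<^sub>R p"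
      by (simp only: p(2) c(3))
    then have "y = m *\<^sub>R x + (1 - m) *\<^sub>R ((1 - c) *\<^sub>R x + c *\<^sub>R p)"
      by (simp add: scaleR_add_left scaleR_add_right)
    then show "y \<in> funk_ball X x m" using mem by (auto simp: funk_ball_def)
  qed
qed

text \<open>Triangle inequality for the Funk metric: substituting \<open>y = m x + (1 - m) p\<close> into
  \<open>z = n y + (1 - n) q\<close> leaves weight \<open>n m\<close> on \<open>x\<close>, and the remaining weight falls on a convex
  combination of \<open>p\<close> and \<open>q\<close>.\<close>

lemma funk_ball_trans:
  assumes "y \<in> funk_ball X x m" "z \<in> funk_ball X y n" "0 \<le> m" "m \<le> 1" "0 \<le> n" "n \<le> 1"
  shows "z \<in> funk_ball X x (n * m)"
proof -
  obtain p where p: "p \<in> closure X" "y = m *\<^sub>R x + (1 - m) *\<^sub>R p"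
    using assms(1) by (auto simp: funk_ball_def)
  obtain q where q: "q \<in> closure X" "z = n *\<^sub>R y + (1 - n) *\<^sub>R q"
    using assms(2) by (auto simp: funk_ball_def)
  have nm: "n * m \<le> 1" using assms by (simp add: mult_le_one)
  show ?thesis
  proof (cases "n * m = 1")
    case True
    have "n * m \<le> n" "n * m \<le> m" using assms by (auto simp: mult_left_le mult_left_le_one_le)
    then have "n = 1" "m = 1" using True assms by auto
    then show ?thesis using assms by (simp add: funk_ball_one)
  next
    case False
    then have pos: "0 < 1 - n * m" using nm by simp
    \<comment> \<open>the weights that remain on \<open>p\<close> and \<open>q\<close>, normalized to sum \<open>1\<close>\<close>
    define u v where "u = n * (1 - m) / (1 - n * m)" and "v = (1 - n) / (1 - n * m)"
    have u: "(1 - n * m) * u = n * (1 - m)" and v: "(1 - n * m) * v = 1 - n"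
      using pos by (auto simp: u_def v_def)
    have "u + v = (n * (1 - m) + (1 - n)) / (1 - n * m)"
      by (simp add: u_def v_def add_divide_distrib)
    also have "\<dots> = 1" using pos by (simp add: algebra_simps)
    finally have uv: "u + v = 1" .
    have "0 \<le> u" "0 \<le> v" using pos assms by (auto simp: u_def v_def)
    then have mem: "u *\<^sub>R p + v *\<^sub>R q \<in> closure X"
      using blend_in_closure p(1) q(1) uv by blast
    have "(n * m) *\<^sub>R x + (1 - n * m) *\<^sub>R (u *\<^sub>R p + v *\<^sub>R q)
        = (n * m) *\<^sub>R x + (((1 - n * m) * u) *\<^sub>R p + ((1 - n * m) * v) *\<^sub>R q)"
      by (simp only: scaleR_add_right scaleR_scaleR)
    also have "\<dots> = z"
      unfolding u v p(2) q(2) by (simp add: scaleR_add_right)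
    finally show ?thesis using mem unfolding funk_ball_def by (metis imageI)
  qed
qed

text \<open>If \<open>y\<close> could be written with a larger weight on \<open>x\<close> than the one belonging to the chord end
  \<open>y'\<close>, the other point \<open>p\<close> would lie beyond \<open>y'\<close>. Then \<open>y'\<close> would be a convex combination
  of \<open>x\<close> and \<open>p\<close> with positive weight on \<open>x\<close>, hence interior.\<close>

lemma mem_funk_ball_iff_chord_ratio:
  assumes "x \<in> X" "y' \<in> frontier X" "y \<in> open_segment x y'" "m \<le> 1"
  shows "y \<in> funk_ball X x m \<longleftrightarrow> m \<le> dist y y' / dist x y'"
proof -
  obtain u where u: "0 < u" "u < 1" "y = (1 - u) *\<^sub>R x + u *\<^sub>R y'" and ne: "x \<noteq> y'"
    using assms(3) by (auto simp: in_segment)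
  have fr: "y' \<in> closure X" "y' \<notin> X"
    using assms(2) by (auto simp: frontier_def interior_X)
  have "y - y' = (1 - u) *\<^sub>R (x - y')" by (simp add: u(3) algebra_simps)
  then have "dist y y' / dist x y' = 1 - u" using u ne by (simp add: dist_norm)
  moreover have "y \<in> funk_ball X x (1 - u)" using u(3) fr(1) by (auto simp: funk_ball_def)
  moreover have "m \<le> 1 - u" if mem: "y \<in> funk_ball X x m"
  proof (rule ccontr)
    assume "\<not> m \<le> 1 - u"
    obtain p where p: "p \<in> closure X" "y = m *\<^sub>R x + (1 - m) *\<^sub>R p"
      using mem by (auto simp: funk_ball_def)
    \<comment> \<open>\<open>c\<close> is the weight of \<open>x\<close> in \<open>y'\<close>, found by eliminating \<open>y\<close> from its two representations\<close>
    define c where "c = (m - (1 - u)) / u"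
    have c: "0 < c" "c \<le> 1" "u * c = m - (1 - u)" "u * (1 - c) = 1 - m"
      using \<open>\<not> m \<le> 1 - u\<close> assms(4) u(1) by (auto simp: c_def field_simps)
    have "u *\<^sub>R y' = (u * c) *\<^sub>R x + (u * (1 - c)) *\<^sub>R p"
      unfolding c using u(3) p(2) by (simp add: algebra_simps)
    also have "\<dots> = u *\<^sub>R (c *\<^sub>R x + (1 - c) *\<^sub>R p)" by (simp add: scaleR_add_right)
    finally have "y' = c *\<^sub>R x + (1 - c) *\<^sub>R p" using u(1) by simp
    then show False using blend_in_domain[OF assms(1) p(1) c(1,2)] fr(2) by simp
  qed
  ultimately show ?thesis using funk_ball_antimono[OF assms(1), of m "1 - u"] u by auto
qed

abbreviation d where "d \<equiv> hilbert_dist X"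

text \<open>For \<open>x \<noteq> y\<close> the admissible \<open>m\<close> and \<open>n\<close> are those up to the two chord ratios, whose product
  is \<open>exp (- d x y)\<close>. The right-hand side also covers \<open>x = y\<close>, so later arguments need no case
  distinction.\<close>

lemma hilbert_dist_le_iff:
  assumes x: "x \<in> X" and y: "y \<in> X" and C: "0 \<le> C"
  shows "d x y \<le> C \<longleftrightarrow>
    (\<exists>m n. 0 < m \<and> m \<le> 1 \<and> 0 < n \<and> n \<le> 1 \<and> exp (- C) \<le> m * n \<and>
       y \<in> funk_ball X x m \<and> x \<in> funk_ball X y n)" (is "_ \<longleftrightarrow> ?R")
proof (cases "x = y")
  case True
  have ?R using C True by (intro exI[of _ 1]) (simp add: funk_ball_one)
  then show ?thesis using True C by (simp add: hilbert_dist_def)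
next
  case False
  obtain x' y' where ends: "chord_ends X x y x' y'"
    using chord_ends_exist[OF open_X convex_X bounded_X x y False] by blast
  then have fr: "x' \<in> frontier X" "y' \<in> frontier X"
    and seg: "x \<in> open_segment y x'" "y \<in> open_segment x y'"
    by (auto simp: chord_ends_def open_segment_commute)
  define M N where "M = dist y y' / dist x y'" and "N = dist x x' / dist y x'"
  have "y \<noteq> y'" "x \<noteq> x'" "x \<noteq> y'" "y \<noteq> x'" using seg by (auto simp: open_segment_def)
  then have pos: "0 < M" "0 < N" by (auto simp: M_def N_def)
  have "dist y y' < dist x y'" "dist x x' < dist y x'"
    using dist_in_open_segment[OF seg(1)] dist_in_open_segment[OF seg(2)]
    by (auto simp: dist_commute)
  then have le1: "M \<le> 1" "N \<le> 1" by (auto simp: M_def N_def divide_le_eq_1)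
  have iff: "y \<in> funk_ball X x m \<longleftrightarrow> m \<le> M" "x \<in> funk_ball X y m \<longleftrightarrow> m \<le> N" if "m \<le> 1" for m
    using mem_funk_ball_iff_chord_ratio x y fr seg that by (auto simp: M_def N_def)
  have "d x y = ln (inverse (M * N))"
    using hilbert_dist_eq[OF ends x y False] by (simp add: M_def N_def field_simps)
  then have "d x y = - ln (M * N)" using pos by (simp only: ln_inverse mult_pos_pos)
  then have "d x y \<le> C \<longleftrightarrow> exp (- C) \<le> M * N"
    using pos ln_ge_iff[of "M * N" "- C"] by auto
  also have "\<dots> \<longleftrightarrow> ?R"
  proof
    assume "exp (- C) \<le> M * N"
    then show ?R using pos le1 iff by blast
  next
    assume ?R
    then obtain m n where mn: "0 < m" "m \<le> 1" "0 < n" "n \<le> 1" "exp (- C) \<le> m * n"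
      "y \<in> funk_ball X x m" "x \<in> funk_ball X y n" by blast
    then have "m * n \<le> M * N" using iff pos by (intro mult_mono) auto
    then show "exp (- C) \<le> M * N" using mn by simp
  qed
  finally show ?thesis .
qed

text \<open>Both weights are at most \<open>1\<close>, so each of them alone is at least \<open>exp (- C)\<close>.\<close>

lemma hilbert_dist_le_imp_funk_ball:
  assumes "x \<in> X" "y \<in> X" "0 \<le> C" "d x y \<le> C"
  shows "y \<in> funk_ball X x (exp (- C))"
proof -
  obtain m n where mn: "0 < m" "m \<le> 1" "0 < n" "n \<le> 1" "exp (- C) \<le> m * n" "y \<in> funk_ball X x m"
    using assms hilbert_dist_le_iff by blast
  then have "m * n \<le> m" by (simp add: mult_left_le)
  with mn(5) have "exp (- C) \<le> m" by (rule order_trans)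
  then show ?thesis using funk_ball_antimono assms(1) mn by blast
qed

section \<open>Metric axioms\<close>

lemma hilbert_dist_nonneg: "0 \<le> d x y"
proof (rule ccontr)
  assume neg: "\<not> 0 \<le> d x y"
  then have xy: "x \<in> X" "y \<in> X" "x \<noteq> y" by (auto simp: hilbert_dist_def split: if_splits)
  \<comment> \<open>the Funk ball of weight \<open>exp 0 = 1\<close> is a single point\<close>
  have "y \<in> funk_ball X x (exp (- 0))"
    by (rule hilbert_dist_le_imp_funk_ball) (use xy neg in auto)
  then show False using xy by (simp add: funk_ball_one)
qed

lemma Metric_space_hilbert: "Metric_space X d"
proof
  show "0 \<le> d x y" for x y by (rule hilbert_dist_nonneg)
next
  have le: "d x y \<le> d y x" if X: "x \<in> X" "y \<in> X" for x y
  proof -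
    obtain m n where "0 < m" "m \<le> 1" "0 < n" "n \<le> 1" "exp (- d y x) \<le> m * n"
      "x \<in> funk_ball X y m" "y \<in> funk_ball X x n"
      using hilbert_dist_le_iff[OF X(2,1) hilbert_dist_nonneg[of y x]] by auto
    then show ?thesis
      using hilbert_dist_le_iff[OF X hilbert_dist_nonneg[of y x]] by (metis mult.commute)
  qed
  fix x y
  show "d x y = d y x"
  proof (cases "x \<in> X \<and> y \<in> X")
    case True
    then show ?thesis using le[of x y] le[of y x] by simp
  next
    case False
    then show ?thesis by (auto simp: hilbert_dist_def)
  qed
next
  fix x y assume X: "x \<in> X" "y \<in> X"
  show "d x y = 0 \<longleftrightarrow> x = y"
  proof
    assume "d x y = 0"
    then show "x = y" using hilbert_dist_le_imp_funk_ball[OF X, of 0] by (simp add: funk_ball_one)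
  qed (simp add: hilbert_dist_def)
next
  fix x y z assume X: "x \<in> X" "y \<in> X" "z \<in> X"
  obtain m n where mn: "0 < m" "m \<le> 1" "0 < n" "n \<le> 1" "exp (- d x y) \<le> m * n"
    "y \<in> funk_ball X x m" "x \<in> funk_ball X y n"
    using hilbert_dist_le_iff[OF X(1,2) hilbert_dist_nonneg[of x y]] by auto
  obtain k l where kl: "0 < k" "k \<le> 1" "0 < l" "l \<le> 1" "exp (- d y z) \<le> k * l"
    "z \<in> funk_ball X y k" "y \<in> funk_ball X z l"
    using hilbert_dist_le_iff[OF X(2,3) hilbert_dist_nonneg[of y z]] by auto
  have "z \<in> funk_ball X x (k * m)" "x \<in> funk_ball X z (n * l)"
    using funk_ball_trans mn kl by auto
  moreover have "exp (- (d x y + d y z)) = exp (- d x y) * exp (- d y z)"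
    by (simp add: exp_add[symmetric])
  then have "exp (- (d x y + d y z)) \<le> (m * n) * (k * l)"
    using mult_mono[OF mn(5) kl(5)] mn kl by simp
  then have "exp (- (d x y + d y z)) \<le> (k * m) * (n * l)" by (simp add: mult_ac)
  moreover have "0 < k * m" "k * m \<le> 1" "0 < n * l" "n * l \<le> 1"
    using mn kl by (auto intro: mult_le_one)
  ultimately show "d x z \<le> d x y + d y z"
    using hilbert_dist_le_iff[OF X(1,3), of "d x y + d y z"] hilbert_dist_nonneg[of x y]
      hilbert_dist_nonneg[of y z] by (auto intro: add_nonneg_nonneg)
qed

sublocale Hilbert: Metric_space X d
  by (rule Metric_space_hilbert)

section \<open>Topology and properness\<close>

text \<open>The point \<open>y\<close> is reached from \<open>x\<close> by going the fraction \<open>1 - exp (- d x y) \<le> d x y\<close> of a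
  segment inside the closure. This makes the Hilbert topology at least as fine as the Euclidean
  one.\<close>

lemma dist_le_hilbert_dist:
  assumes "x \<in> X" "y \<in> X"
  shows "dist x y \<le> d x y * diameter (closure X)"
proof -
  define m where "m = exp (- d x y)"
  have m: "m \<le> 1" "1 - m \<le> d x y"
    using hilbert_dist_nonneg[of x y] exp_ge_add_one_self[of "- d x y"] by (auto simp: m_def)
  have "y \<in> funk_ball X x m"
    unfolding m_def
    by (rule hilbert_dist_le_imp_funk_ball) (use assms hilbert_dist_nonneg in auto)
  then obtain p where p: "p \<in> closure X" "y = m *\<^sub>R x + (1 - m) *\<^sub>R p"
    by (auto simp: funk_ball_def)
  have "dist x p \<le> diameter (closure X)"
    using diameter_bounded_bound[of "closure X"] compact_closure_X compact_imp_bounded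
      assms(1) closure_subset p(1) by (metis subsetD)
  moreover have "x - y = (1 - m) *\<^sub>R (x - p)" by (simp add: p(2) algebra_simps)
  then have "dist x y = (1 - m) * dist x p" using m by (simp add: dist_norm)
  ultimately show ?thesis
    using m hilbert_dist_nonneg[of x y] by (auto intro: mult_mono)
qed

text \<open>If \<open>x \<noteq> y\<close>, the segment from \<open>x\<close> to \<open>y\<close> can be prolonged beyond \<open>y\<close> by the length \<open>\<delta>\<close> inside
  the closure, and its new endpoint carries the remaining weight.\<close>

lemma mem_funk_ball_of_cball:
  assumes "cball y \<delta> \<subseteq> closure X" "0 < \<delta>"
  shows "y \<in> funk_ball X x (\<delta> / (\<delta> + dist x y))"
proof (cases "x = y")
  case True
  then show ?thesis using assms by (simp add: funk_ball_one)
next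
  case False
  define r where "r = dist x y"
  have r: "0 < r" using False by (simp add: r_def)
  define m where "m = \<delta> / (\<delta> + r)"
  have m: "(1 - m) * (\<delta> / r) = m" using r assms(2) by (simp add: m_def field_simps)
  define p where "p = y + (\<delta> / r) *\<^sub>R (y - x)"
  have "dist y p = \<delta>"
    using r assms(2) by (simp add: p_def dist_norm r_def norm_minus_commute)
  then have "p \<in> closure X" using assms(1) by auto
  moreover have "m *\<^sub>R x + (1 - m) *\<^sub>R p
      = m *\<^sub>R x + ((1 - m) *\<^sub>R y + ((1 - m) * (\<delta> / r)) *\<^sub>R (y - x))"
    by (simp only: p_def scaleR_add_right scaleR_scaleR)
  then have "m *\<^sub>R x + (1 - m) *\<^sub>R p = y"
    unfolding m by (simp add: algebra_simps)
  ultimately show ?thesis unfolding funk_ball_def m_def r_def by (metis imageI)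
qed

text \<open>Away from the boundary the Hilbert metric is Lipschitz in the Euclidean one, so the two
  topologies agree.\<close>

lemma hilbert_dist_le_of_cballs:
  assumes "x \<in> X" "y \<in> X" "cball x \<delta> \<subseteq> closure X" "cball y \<delta> \<subseteq> closure X" "0 < \<delta>"
  shows "d x y \<le> 2 * (dist x y / \<delta>)"
proof -
  define r where "r = dist x y"
  define m where "m = \<delta> / (\<delta> + r)"
  have r: "0 \<le> r" by (simp add: r_def)
  have m: "0 < m" "m \<le> 1" using r assms(5) by (auto simp: m_def)
  have "1 / m = 1 + r / \<delta>" using assms(5) by (simp add: m_def field_simps)
  also have "\<dots> \<le> exp (r / \<delta>)" by simp
  finally have "exp (- (r / \<delta>)) \<le> m"
    using m by (simp add: exp_minus field_simps)
  then have "exp (- (r / \<delta>)) * exp (- (r / \<delta>)) \<le> m * m"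
    using m by (intro mult_mono) auto
  then have "exp (- (2 * (r / \<delta>))) \<le> m * m" by (simp add: exp_add[symmetric])
  moreover have "y \<in> funk_ball X x m" "x \<in> funk_ball X y m"
    using mem_funk_ball_of_cball[OF assms(4,5), of x] mem_funk_ball_of_cball[OF assms(3,5), of y]
    by (auto simp: m_def r_def dist_commute)
  ultimately have "d x y \<le> 2 * (r / \<delta>)"
    using hilbert_dist_le_iff[OF assms(1,2), of "2 * (r / \<delta>)"] m r assms(5) by auto
  then show ?thesis by (simp add: r_def)
qed

lemma mtopology_hilbert: "Hilbert.mtopology = top_of_set X"
proof -
  have "openin Hilbert.mtopology U \<longleftrightarrow> U \<subseteq> X \<and> open U" for U
  proof (intro iffI conjI)
    assume U: "openin Hilbert.mtopology U"
    show sub: "U \<subseteq> X" using U Hilbert.openin_mtopology by blast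
    show "open U"
      unfolding open_dist
    proof
      fix x assume "x \<in> U"
      then obtain r where r: "0 < r" "Hilbert.mball x r \<subseteq> U"
        using U Hilbert.openin_mtopology by blast
      have x: "x \<in> X" using \<open>x \<in> U\<close> sub by blast
      then obtain \<delta> where \<delta>: "0 < \<delta>" "cball x \<delta> \<subseteq> X"
        using open_X open_contains_cball by blast
      \<comment> \<open>within \<open>\<delta> / 2\<close> of \<open>x\<close>, balls of radius \<open>\<delta> / 2\<close> stay in \<open>X\<close>, where the Lipschitz
        constant is \<open>4 / \<delta>\<close>\<close>
      define e where "e = min (\<delta> / 2) (r * \<delta> / 4)"
      have "y \<in> U" if "dist y x < e" for y
      proof -
        have near: "dist x y < \<delta> / 2" "dist x y < r * \<delta> / 4"
          using that by (auto simp: e_def dist_commute)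
        have sub2: "cball y (\<delta> / 2) \<subseteq> cball x \<delta>"
          using near(1) by (auto simp: cball_subset_cball_iff dist_commute)
        have "cball x (\<delta> / 2) \<subseteq> cball x \<delta>" using \<delta>(1) by (intro subset_cball) simp
        moreover have y: "y \<in> X" using near(1) \<delta> by auto
        ultimately have "d x y \<le> 2 * (dist x y / (\<delta> / 2))"
          using hilbert_dist_le_of_cballs[OF x y, of "\<delta> / 2"] \<delta> sub2 closure_subset[of X]
          by auto
        also have "\<dots> < r" using near(2) \<delta>(1) r(1) by (simp add: field_simps)
        finally show ?thesis using r(2) x y by auto
      qed
      moreover have "0 < e" using \<delta>(1) r(1) by (simp add: e_def)
      ultimately show "\<exists>e>0. \<forall>y. dist y x < e \<longrightarrow> y \<in> U" by blast
    qed
  next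
    assume U: "U \<subseteq> X \<and> open U"
    show "openin Hilbert.mtopology U"
      unfolding Hilbert.openin_mtopology
    proof (intro conjI ballI allI impI)
      fix x assume x: "x \<in> U"
      then obtain e where e: "0 < e" "ball x e \<subseteq> U" using U open_contains_ball by blast
      define D where "D = diameter (closure X) + 1"
      have D: "0 < D"
        using diameter_ge_0[of "closure X"] bounded_closure[OF bounded_X]
        by (simp add: D_def add_nonneg_pos)
      have "Hilbert.mball x (e / D) \<subseteq> U"
      proof
        fix y assume "y \<in> Hilbert.mball x (e / D)"
        then have y: "x \<in> X" "y \<in> X" "d x y < e / D" by auto
        have "dist x y \<le> d x y * diameter (closure X)" using dist_le_hilbert_dist y by blast
        also have "\<dots> \<le> d x y * D"
          using hilbert_dist_nonneg by (intro mult_left_mono) (auto simp: D_def)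
        also have "\<dots> < e" using y(3) D by (simp add: field_simps)
        finally show "y \<in> U" using e by auto
      qed
      then show "\<exists>r>0. Hilbert.mball x r \<subseteq> U" using e D by (meson divide_pos_pos)
    qed (use U in blast)
  qed
  then show ?thesis
    by (auto simp: topology_eq openin_open_eq[OF open_X])
qed

text \<open>A bounded set lies in some \<open>funk_ball X x m\<close> with \<open>m > 0\<close>, which is the continuous image of the
  compact closure and avoids the boundary.\<close>

lemma mbounded_iff_in_compact:
  "Hilbert.mbounded S \<longleftrightarrow> (\<exists>K. compact K \<and> S \<subseteq> K \<and> K \<subseteq> X)"
proof
  assume bdd: "Hilbert.mbounded S"
  obtain x where x: "x \<in> X" using nonempty_X by blast
  have "Hilbert.mbounded (insert x S)" using bdd x by (simp add: Hilbert.mbounded_insert)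
  then obtain B where B: "0 < B" "S \<subseteq> X" "\<And>y. y \<in> S \<Longrightarrow> d x y \<le> B"
    unfolding Hilbert.mbounded_alt_pos by blast
  show "\<exists>K. compact K \<and> S \<subseteq> K \<and> K \<subseteq> X"
  proof (intro exI conjI)
    show "compact (funk_ball X x (exp (- B)))"
      unfolding funk_ball_def
      by (intro compact_continuous_image compact_closure_X continuous_intros)
    show "S \<subseteq> funk_ball X x (exp (- B))"
      using B x hilbert_dist_le_imp_funk_ball[of x _ B] by auto
    show "funk_ball X x (exp (- B)) \<subseteq> X"
      using blend_in_domain[OF x] B(1) by (auto simp: funk_ball_def)
  qed
next
  assume "\<exists>K. compact K \<and> S \<subseteq> K \<and> K \<subseteq> X"
  then obtain K where K: "compact K" "S \<subseteq> K" "K \<subseteq> X" by blast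
  then have "compactin Hilbert.mtopology K"
    by (simp add: mtopology_hilbert compactin_subtopology)
  then show "Hilbert.mbounded S"
    using Hilbert.compactin_imp_mbounded Hilbert.mbounded_subset K(2) by blast
qed

lemma proper_space_hilbert: "Hilbert.proper_space"
  unfolding Hilbert.proper_space_def
proof (intro allI impI, elim conjE)
  fix S assume S: "closedin Hilbert.mtopology S" "Hilbert.mbounded S"
  then obtain K where K: "compact K" "S \<subseteq> K" "K \<subseteq> X" unfolding mbounded_iff_in_compact by blast
  then have "compactin Hilbert.mtopology K"
    by (simp add: mtopology_hilbert compactin_subtopology)
  then show "compactin Hilbert.mtopology S"
    using S(1) K(2) closed_compactin by blast
qed

lemma metrizable_compactification_closure:
  "Hilbert.metrizable_compactification (top_of_set (closure X))"
  unfolding Hilbert.metrizable_compactification_def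
proof (intro conjI)
  show "compact_space (top_of_set (closure X))"
    using compact_closure_X by (simp add: compact_space_subtopology)
  show "metrizable_space (top_of_set (closure X))"
    by (simp add: metrizable_space_euclidean metrizable_space_subtopology)
  show "X \<subseteq> topspace (top_of_set (closure X))" by (simp add: closure_subset)
  show "subtopology (top_of_set (closure X)) X = Hilbert.mtopology"
    by (simp add: mtopology_hilbert subtopology_subtopology inf_absorb2 closure_subset)
  show "top_of_set (closure X) closure_of X = topspace (top_of_set (closure X))"
    by (simp add: closure_of_subtopology inf_absorb2 closure_subset)
qed

section \<open>Proper convexity and the Higson property\<close>

lemma properly_convex_closure_iff:
  "properly_convex (closure X) \<longleftrightarrow>
     (\<forall>a\<in>closure X. \<forall>b\<in>closure X. open_segment a b \<subseteq> X)"
  by (simp add: properly_convex_def convex_interior_closure[OF convex_X] interior_X)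

text \<open>The bounded set is the compact set \<open>K\<close> of all \<open>n y + (1 - n) q\<close> that have weight
  \<open>n \<ge> exp (- C)\<close> on \<open>y\<close> and distance at least \<open>\<eta>\<close> from \<open>y\<close>. The distance excludes the degenerate
  cases \<open>n = 1\<close> and \<open>y = q\<close>, so every point of \<open>K\<close> lies strictly between \<open>y\<close> and \<open>q\<close>, and proper
  convexity applies.\<close>

lemma euclidean_close_outside_bounded:
  assumes "properly_convex (closure X)" "0 < \<eta>" "0 < C"
  obtains B where "B \<subseteq> X" "Hilbert.mbounded B"
    "\<And>x y. \<lbrakk>x \<in> X; y \<in> X; d x y \<le> C; x \<notin> B\<rbrakk> \<Longrightarrow> dist x y < \<eta>"
proof -
  let ?blend = "\<lambda>(n::real, y::'a, q::'a). n *\<^sub>R y + (1 - n) *\<^sub>R q"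
  define P where "P = {exp (- C)..1} \<times> closure X \<times> closure X"
  define Z where "Z = P \<inter> {t. \<eta> \<le> dist (?blend t) (fst (snd t))}"
  define K where "K = ?blend ` Z"
  have cont: "continuous_on A ?blend" for A
    unfolding case_prod_unfold by (intro continuous_intros)
  have "closed {t. \<eta> \<le> dist (?blend t) (fst (snd t))}"
    by (intro closed_Collect_le continuous_intros cont)
  moreover have "compact P"
    unfolding P_def by (intro compact_Times compact_closure_X compact_Icc)
  ultimately have "compact K"
    unfolding K_def Z_def by (intro compact_continuous_image cont compact_Int_closed)
  moreover have sub: "K \<subseteq> X"
  proof
    fix x assume "x \<in> K"
    then obtain n y q where nyq: "n \<in> {exp (- C)..1}" "y \<in> closure X" "q \<in> closure X"
      and x: "x = n *\<^sub>R y + (1 - n) *\<^sub>R q" and far: "\<eta> \<le> dist x y"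
      by (auto simp: K_def Z_def P_def)
    have "0 < n" using nyq(1) less_le_trans[OF exp_gt_zero, of "- C" n] by simp
    moreover have "n \<noteq> 1" "y \<noteq> q"
      using far assms(2) by (auto simp: x scaleR_add_left[symmetric])
    ultimately have "x \<in> open_segment y q"
      using nyq(1) unfolding in_segment x by (intro conjI exI[of _ "1 - n"]) auto
    then show "x \<in> X" using assms(1) nyq properly_convex_closure_iff by blast
  qed
  ultimately have "Hilbert.mbounded K" unfolding mbounded_iff_in_compact by blast
  moreover have "dist x y < \<eta>" if xy: "x \<in> X" "y \<in> X" "d x y \<le> C" "x \<notin> K" for x y
  proof (rule ccontr)
    assume far: "\<not> dist x y < \<eta>"
    have "x \<in> funk_ball X y (exp (- C))"
      by (rule hilbert_dist_le_imp_funk_ball) (use xy assms(3) Hilbert.commute in auto)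
    then obtain q where "q \<in> closure X" "x = ?blend (exp (- C), y, q)"
      by (auto simp: funk_ball_def)
    moreover from this have "(exp (- C), y, q) \<in> Z"
      using far xy(2) assms(3) closure_subset[of X] by (auto simp: Z_def P_def)
    ultimately show False using xy(4) unfolding K_def by blast
  qed
  ultimately show ?thesis using that sub by blast
qed

lemma properly_convex_imp_coarse:
  assumes "properly_convex (closure X)"
  shows "Hilbert.coarse_compactification (top_of_set (closure X))"
  unfolding Hilbert.coarse_compactification_def
proof (intro conjI allI impI metrizable_compactification_closure)
  fix f :: "'a \<Rightarrow> complex"
  assume "continuous_map (top_of_set (closure X)) euclidean f"
  then have cont: "continuous_on (closure X) f" by simp
  then have unif: "uniformly_continuous_on (closure X) f"
    using compact_closure_X by (rule compact_uniformly_continuous)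
  show "Hilbert.Higson_function f"
    unfolding Hilbert.Higson_function_def
  proof (intro conjI allI impI)
    show "continuous_map Hilbert.mtopology euclidean f"
      using continuous_on_subset[OF cont closure_subset] by (simp add: mtopology_hilbert)
    have "bounded (f ` closure X)"
      using cont compact_closure_X compact_continuous_image compact_imp_bounded by blast
    then show "bounded (f ` X)"
      by (rule bounded_subset) (simp add: closure_subset image_mono)
  next
    fix \<epsilon> C :: real assume pos: "0 < \<epsilon>" "0 < C"
    obtain \<eta> where \<eta>: "0 < \<eta>"
      "\<And>x y. \<lbrakk>x \<in> closure X; y \<in> closure X; dist y x < \<eta>\<rbrakk> \<Longrightarrow> dist (f y) (f x) < \<epsilon>"
      using unif pos(1) unfolding uniformly_continuous_on_def by metis
    obtain B where B: "B \<subseteq> X" "Hilbert.mbounded B"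
      "\<And>x y. \<lbrakk>x \<in> X; y \<in> X; d x y \<le> C; x \<notin> B\<rbrakk> \<Longrightarrow> dist x y < \<eta>"
      using euclidean_close_outside_bounded[OF assms \<eta>(1) pos(2)] by blast
    have "cmod (f x - f y) < \<epsilon>" if "x \<in> X" "y \<in> X" "d x y \<le> C" "x \<notin> B" for x y
      using B(3)[OF that] \<eta>(2)[of y x] that closure_subset[of X] by (auto simp: dist_norm)
    then show "\<exists>B\<subseteq>X. Hilbert.mbounded B \<and>
        (\<forall>x\<in>X. \<forall>y\<in>X. d x y \<le> C \<and> x \<notin> B \<longrightarrow> cmod (f x - f y) < \<epsilon>)"
      using B(1,2) by blast
  qed
qed

text \<open>The homothety with centre \<open>w\<close> and ratio \<open>1 - t\<close> preserves convex combinations and maps the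
  closure of \<open>X\<close> into itself.\<close>

lemma funk_ball_push:
  assumes "w \<in> X" "y \<in> funk_ball X x m" "0 \<le> t" "t \<le> 1"
  shows "t *\<^sub>R w + (1 - t) *\<^sub>R y \<in> funk_ball X (t *\<^sub>R w + (1 - t) *\<^sub>R x) m"
proof -
  obtain p where p: "p \<in> closure X" "y = m *\<^sub>R x + (1 - m) *\<^sub>R p"
    using assms(2) by (auto simp: funk_ball_def)
  have "t *\<^sub>R w + (1 - t) *\<^sub>R p \<in> closure X"
    using blend_in_closure assms p(1) closure_subset[of X] by auto
  moreover have "t *\<^sub>R w + (1 - t) *\<^sub>R y
      = m *\<^sub>R (t *\<^sub>R w + (1 - t) *\<^sub>R x) + (1 - m) *\<^sub>R (t *\<^sub>R w + (1 - t) *\<^sub>R p)"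
    unfolding p(2) by (simp add: algebra_simps)
  ultimately show ?thesis unfolding funk_ball_def by blast
qed

text \<open>Near a point \<open>z\<close> of a segment that is not absorbed by \<open>X\<close>, points can escape to the boundary in
  pairs whose Hilbert distance stays bounded and whose Euclidean distance stays away from \<open>0\<close>.\<close>

lemma coarse_imp_properly_convex:
  assumes coarse: "Hilbert.coarse_compactification (top_of_set (closure X))"
  shows "properly_convex (closure X)"
  unfolding properly_convex_closure_iff
proof (intro ballI subsetI, rule ccontr)
  fix a b z assume a: "a \<in> closure X" and b: "b \<in> closure X"
    and z: "z \<in> open_segment a b" "z \<notin> X"
  obtain s where s: "0 < s" "s < 1" "z = (1 - s) *\<^sub>R a + s *\<^sub>R b" and ab: "a \<noteq> b"
    using z(1) by (auto simp: in_segment)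
  define v where "v = (1 / 2) *\<^sub>R z + (1 - 1 / 2) *\<^sub>R b"
  \<comment> \<open>\<open>n\<close> is the weight of \<open>v\<close> in \<open>z\<close> as a point between \<open>v\<close> and \<open>a\<close>: from \<open>a\<close> to \<open>b\<close>, the
    points \<open>z\<close> and \<open>v\<close> have parameters \<open>s\<close> and \<open>(1 + s) / 2\<close>\<close>
  define n where "n = 2 * s / (1 + s)"
  have n: "0 < n" "n \<le> 1" "(1 + s) * n = 2 * s" "(1 + s) * (1 - n) = 1 - s"
    using s by (auto simp: n_def field_simps)
  have "(1 + s) *\<^sub>R (n *\<^sub>R v + (1 - n) *\<^sub>R a) = (2 * s) *\<^sub>R v + (1 - s) *\<^sub>R a"
    by (simp only: scaleR_add_right scaleR_scaleR n)
  also have "\<dots> = s *\<^sub>R z + ((1 - s) *\<^sub>R a + s *\<^sub>R b)"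
    by (simp add: v_def scaleR_add_right)
  also have "\<dots> = (1 + s) *\<^sub>R z" by (simp add: s(3)[symmetric] scaleR_add_left)
  finally have "z = n *\<^sub>R v + (1 - n) *\<^sub>R a" using s(1) by simp
  then have shr: "v \<in> funk_ball X z (1 / 2)" "z \<in> funk_ball X v n"
    unfolding funk_ball_def v_def using a b by blast+
  have v: "v \<in> closure X" and zc: "z \<in> closure X"
    unfolding v_def s(3) using s a b by (auto intro!: blend_in_closure)
  have "2 *\<^sub>R (v - z) = b - z"
    by (simp add: v_def scaleR_diff_right scaleR_add_right scaleR_2)
  moreover have "b \<noteq> z" using z(1) by (auto simp: open_segment_def)
  ultimately have vz: "v \<noteq> z" by auto
  define C where "C = ln (2 / n)"
  have C: "0 < C" "exp (- C) = 1 / 2 * n" using n by (auto simp: C_def exp_minus)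
  \<comment> \<open>a linear functional that tells \<open>z\<close> from \<open>v\<close>\<close>
  define f where "f w = complex_of_real (w \<bullet> (v - z))" for w
  have "continuous_map (top_of_set (closure X)) euclidean f"
    unfolding f_def by (simp, intro continuous_intros)
  then have "Hilbert.Higson_function f"
    using coarse by (simp add: Hilbert.coarse_compactification_def)
  moreover define \<epsilon> where "\<epsilon> = (norm (v - z))\<^sup>2 / 2"
  have "0 < \<epsilon>" using vz by (simp add: \<epsilon>_def)
  ultimately obtain B where B: "Hilbert.mbounded B"
    "\<And>x y. \<lbrakk>x \<in> X; y \<in> X; d x y \<le> C; x \<notin> B\<rbrakk> \<Longrightarrow> cmod (f x - f y) < \<epsilon>"
    using C(1) unfolding Hilbert.Higson_function_def by metis
  obtain K where K: "compact K" "B \<subseteq> K" "K \<subseteq> X"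
    using B(1) unfolding mbounded_iff_in_compact by blast
  obtain w where w: "w \<in> X" using nonempty_X by blast
  \<comment> \<open>pushing \<open>z\<close> and \<open>v\<close> slightly towards \<open>w\<close> brings both into \<open>X\<close> while the copy of \<open>z\<close> avoids \<open>K\<close>\<close>
  have "open (- K)" "z \<in> - K" using K z(2) by (auto simp: compact_imp_closed open_Compl)
  then obtain \<delta> where \<delta>: "0 < \<delta>" "ball z \<delta> \<subseteq> - K" using open_contains_ball by blast
  have wz: "0 < dist w z" using w z(2) by auto
  define t where "t = min (1 / 2) (\<delta> / (2 * dist w z))"
  have "t \<le> \<delta> / (2 * dist w z)" by (simp add: t_def)
  then have "t * dist w z \<le> \<delta> / 2" using wz by (simp add: field_simps)
  then have t: "0 < t" "t \<le> 1 / 2" "t * dist w z < \<delta>"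
    using \<delta>(1) wz by (auto simp: t_def)
  define x y where "x = t *\<^sub>R w + (1 - t) *\<^sub>R z" and "y = t *\<^sub>R w + (1 - t) *\<^sub>R v"
  have X: "x \<in> X" "y \<in> X"
    unfolding x_def y_def using blend_in_domain[OF w] zc v t by auto
  have "z - x = t *\<^sub>R (z - w)" by (simp add: x_def algebra_simps)
  then have "dist z x = t * dist w z" using t(1) by (simp add: dist_norm norm_minus_commute)
  then have "x \<in> ball z \<delta>" using t(3) by simp
  then have "x \<notin> B" using \<delta>(2) K(2) by blast
  moreover have "y \<in> funk_ball X x (1 / 2)" "x \<in> funk_ball X y n"
    unfolding x_def y_def using funk_ball_push[OF w] shr t by auto
  then have "d x y \<le> C"
    using hilbert_dist_le_iff[OF X, of C] C n by auto
  ultimately have "cmod (f x - f y) < \<epsilon>" using B(2) X by blast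
  moreover have "y - x = (1 - t) *\<^sub>R (v - z)" by (simp add: x_def y_def algebra_simps)
  then have "(y - x) \<bullet> (v - z) = (1 - t) * (norm (v - z))\<^sup>2" by (simp add: power2_norm_eq_inner)
  then have "f y - f x = of_real ((1 - t) * (norm (v - z))\<^sup>2)"
    by (simp add: f_def inner_diff_left flip: of_real_diff)
  then have "cmod (f x - f y) = (1 - t) * (norm (v - z))\<^sup>2"
    using t by (simp only: norm_minus_commute[of "f x" "f y"] norm_of_real abs_of_nonneg
        mult_nonneg_nonneg zero_le_power2)
  moreover have "1 / 2 * (norm (v - z))\<^sup>2 \<le> (1 - t) * (norm (v - z))\<^sup>2"
    using t by (intro mult_right_mono) auto
  ultimately show False by (simp add: \<epsilon>_def)
qed

end

theorem theorem1p3: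
  fixes X :: "(real ^ 'n) set"
  assumes "CARD('n) \<ge> 2"
    and "open X" and "convex X" and "bounded X" and "X \<noteq> {}"
  shows "corona X (hilbert_dist X) (top_of_set (closure X)) (closure X - X)
         \<longleftrightarrow> properly_convex (closure X)"
proof -
  interpret bounded_convex_domain X
    using assms by unfold_locales
  show ?thesis
    unfolding corona_def
    using Metric_space_hilbert proper_space_hilbert properly_convex_imp_coarse
      coarse_imp_properly_convex by auto
qed

end
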